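(* Let $p,q\in\mathbb{N}$, let $\kappa,\kappa_{i\to}\in C^q(\Omega)$, and let the reconstruction function $\kappa_{i\to}$ at the point $\boldsymbol{x}_i$ fulfill the reconstruction property $$\partial^{\boldsymbol{\alpha}}\kappa_{i\to}(\boldsymbol{x}_i)=\frac{\partial^{\boldsymbol{\alpha}}\kappa(\boldsymbol{x}_i)}{2^{|\boldsymbol{\alpha}|}}+O(h^{q+1-|\boldsymbol{\alpha}|})\qquad\text{for all }\boldsymbol{\alpha}\in\mathbb{N}_0^d\text{ with }|\boldsymbol{\alpha}|\le q .$$ If the coefficients $c_{ij}^\Delta$, $j\in\mathcal{S}_i$, of the discrete Laplace operator fulfill $$\Delta v(\boldsymbol{x}_i)=\sum_{j\in\mathcal{S}_i}c_{ij}^\Delta v(\boldsymbol{x}_j)+O(h^p)$$ for sufficiently smooth functions $v\colon\Omega\to\mathbb{R}$, then the derived diffusion operator, with coefficients $$c_{ij}^{\nabla\cdot(\kappa\nabla)}=\kappa_{i\to}(\boldsymbol{x}_j)\,c_{ij}^\Delta\quad(j\in\mathcal{N}_i),\qquad c_{ii}^{\nabla\cdot(\kappa\nabla)}=-\sum_{j\in\mathcal{N}_i}c_{ij}^{\nabla\cdot(\kappa\nabla)},$$ satisfies the consistency conditions $$\sum_{j\in\mathcal{S}_i}c_{ij}^{\nabla\cdot(\kappa\nabla)}(\boldsymbol{x}_j-\boldsymbol{x}_i)^{\boldsymbol{\alpha}}=\begin{cases}0, & \text{if }\boldsymbol{\alpha}=\boldsymbol{0},\\ \partial_k\kappa(\boldsymbol{x}_i)+O(h^p)+O(h^q),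 & \text{if }\boldsymbol{\alpha}=\boldsymbol{e}_k,\\ 2\kappa(\boldsymbol{x}_i)+O(h^p)+O(h^{q+1}), & \text{if }\boldsymbol{\alpha}=2\boldsymbol{e}_k,\\ O(h^p), & \text{else,}\end{cases}$$ for all $\boldsymbol{\alpha}\in\mathbb{N}_0^d$ (here $k\in\{1,\dots,d\}$).
   Context: $\Omega\subset\mathbb{R}^d$ is a closed domain, discretized by a point cloud $\Omega_h=\{\boldsymbol{x}_1,\dots,\boldsymbol{x}_N\}\subset\Omega$. The function $h\colon\Omega\to\mathbb{R}^+$ is the interaction radius (smoothing length). The stencil of $\boldsymbol{x}_i\in\Omega_h$ is $\mathcal{S}_i=\{j : \|\boldsymbol{x}_j-\boldsymbol{x}_i\|\le h(\boldsymbol{x}_i)\}$ and its neighbors are $\mathcal{N}_i=\mathcal{S}_i\setminus\{i\}$. The Landau notation $O(h^s)$ refers to the limit $h\to 0$, meaning that the interaction radius $h$ converges uniformly to the zero function. The diffusivity $\kappa\colon\Omega\to\mathbb{R}$ is a scalar function with $0<\kappa_{\min}<\kappa<\kappa_{\max}$ for constants $\kappa_{\min},\kappa_{\max}$. The function $\kappa_{i\to}\colon\Omega\to\mathbb{R}$ serves to approximate the diffusivity at mid-points: $\kappa_{i\to}(\boldsymbol{x}_j)$ is a reconstruction of $\kappa\big(\tfrac{\boldsymbol{x}_i+\boldsymbol{x}_j}{2}\big)$. The real coefficients $c_{ij}^\Delta$ ($j\in\mathcal{S}_i$) represent a discrete Laplace operator at $\boldsymbol{x}_i$. The derived diffusion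 operator approximates $\nabla\cdot(\kappa\nabla u)(\boldsymbol{x}_i)$ by $\sum_{j\in\mathcal{S}_i}c_{ij}^{\nabla\cdot(\kappa\nabla)}u(\boldsymbol{x}_j)=\sum_{j\in\mathcal{N}_i}\kappa_{i\to}(\boldsymbol{x}_j)c_{ij}^\Delta(u(\boldsymbol{x}_j)-u(\boldsymbol{x}_i))$. Notation: $\mathbb{N}=\{1,2,\dots\}$ and $\mathbb{N}_0=\mathbb{N}\cup\{0\}$; for $\boldsymbol{\alpha}\in\mathbb{N}_0^d$, $\boldsymbol{x}^{\boldsymbol{\alpha}}=\prod_k x_k^{\alpha_k}$, $|\boldsymbol{\alpha}|=\sum_k\alpha_k$, $\partial^{\boldsymbol{\alpha}}=\prod_k\partial_k^{\alpha_k}$; $\boldsymbol{e}_k$ is the $k$th standard basis vector of $\mathbb{R}^d$.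
   Formalization: The reconstruction function is additionally assumed sufficiently smooth (C^r, r≥2, derivatives bounded near x_i uniformly as h→0), and the discrete Laplacian's O(h^p) is uniform over such function families; with only C^q the claim fails. *)

theory Defs
  imports "HOL-Analysis.Analysis" "HOL-Library.Landau_Symbols"
begin

definition closed_domain :: "(real^'d) set \<Rightarrow> bool" where
  "closed_domain \<Omega> \<longleftrightarrow> (\<exists>U. open U \<and> connected U \<and> U \<noteq> {} \<and> \<Omega> = closure U)"


(* The partial derivative is the usual one in the interior of \<Omega>; at boundary points it is the
   limit of the values in the interior. *)

definition partial_deriv ::
    "(real^'d) set \<Rightarrow> 'd \<Rightarrow> (real^'d \<Rightarrow> real) \<Rightarrow> real^'d \<Rightarrow> real" where
  "partial_deriv \<Omega> k f x =
     (let D = (\<lambda>y. deriv (\<lambda>t. f (y + t *\<^sub>R axis k 1)) 0)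
      in if x \<in> interior \<Omega> then D x else Lim (at x within interior \<Omega>) D)"

(* C^n(\<Omega>) for a closed domain \<Omega>: all partial derivatives of order up to n exist in the interior and
   extend continuously to \<Omega>.  Continuity of partial_deriv \<Omega> k f on \<Omega> includes the existence of the
   limits at the boundary. *)

fun C_on :: "nat \<Rightarrow> (real^'d) set \<Rightarrow> (real^'d \<Rightarrow> real) \<Rightarrow> bool" where
  "C_on 0 \<Omega> f = continuous_on \<Omega> f"
| "C_on (Suc n) \<Omega> f =
     (continuous_on \<Omega> f \<and>
      (\<forall>k. (\<forall>x\<in>interior \<Omega>. (\<lambda>t. f (x + t *\<^sub>R axis k 1)) differentiable (at 0)) \<and>
           C_on n \<Omega> (partial_deriv \<Omega> k f)))"

definition laplacian ::
    "(real^'d) set \<Rightarrow> (real^'d \<Rightarrow> real) \<Rightarrow> real^'d \<Rightarrow> real" where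
  "laplacian \<Omega> f x = (\<Sum>k\<in>UNIV. partial_deriv \<Omega> k (partial_deriv \<Omega> k f) x)"


(* Unlike real^'d, this admits an additional sort constraint on 'd. *)

type_synonym 'd point = "real^'d"

type_synonym 'd multi_index = "'d \<Rightarrow> nat"

definition mi_degree :: "'d::finite multi_index \<Rightarrow> nat" where
  "mi_degree \<alpha> = (\<Sum>k\<in>UNIV. \<alpha> k)"

definition mi_unit :: "'d \<Rightarrow> 'd multi_index" where
  "mi_unit k = (\<lambda>l. if l = k then 1 else 0)"

definition mi_power :: "real^'d \<Rightarrow> 'd multi_index \<Rightarrow> real" where
  "mi_power x \<alpha> = (\<Prod>k\<in>UNIV. (x $ k) ^ \<alpha> k)"

(* The linear order on the coordinates only fixes the order in which the partial derivatives are
   taken; it is irrelevant for functions of class C^n with n \<ge> mi_degree \<alpha>. *)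

definition mi_deriv ::
    "'d::{finite,linorder} point set \<Rightarrow> 'd multi_index \<Rightarrow> ('d point \<Rightarrow> real) \<Rightarrow> 'd point \<Rightarrow> real" where
  "mi_deriv \<Omega> \<alpha> f =
     foldr (\<lambda>k. partial_deriv \<Omega> k ^^ \<alpha> k) (sorted_list_of_set UNIV) f"


(* A point cloud of N points is given by its enumeration X 1, ..., X N. *)

definition point_cloud :: "(real^'d) set \<Rightarrow> nat \<Rightarrow> (nat \<Rightarrow> real^'d) \<Rightarrow> bool" where
  "point_cloud \<Omega> N X \<longleftrightarrow> inj_on X {1..N} \<and> X ` {1..N} \<subseteq> \<Omega>"

definition stencil ::
    "nat \<Rightarrow> (nat \<Rightarrow> real^'d) \<Rightarrow> (real^'d \<Rightarrow> real) \<Rightarrow> nat \<Rightarrow> nat set" where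
  "stencil N X h i = {j \<in> {1..N}. norm (X j - X i) \<le> h (X i)}"

definition neighbors ::
    "nat \<Rightarrow> (nat \<Rightarrow> real^'d) \<Rightarrow> (real^'d \<Rightarrow> real) \<Rightarrow> nat \<Rightarrow> nat set" where
  "neighbors N X h i = stencil N X h i - {i}"

(* Coefficients of the derived diffusion operator at X i, for the reconstruction function R at X i
   and the coefficients c of the discrete Laplace operator at X i. *)

definition diffusion_coeff ::
    "nat \<Rightarrow> (nat \<Rightarrow> real^'d) \<Rightarrow> (real^'d \<Rightarrow> real) \<Rightarrow> nat \<Rightarrow>
     (real^'d \<Rightarrow> real) \<Rightarrow> (nat \<Rightarrow> real) \<Rightarrow> nat \<Rightarrow> real" where
  "diffusion_coeff N X h i R c j =
     (if j = i then - (\<Sum>l\<in>neighbors N X h i. R (X l) * c l) else R (X j) * c j)"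


(* The limit h \<rightarrow> 0 runs along a filter F on an arbitrary type of indices \<nu>, each of which carries a
   discretization: N \<nu>, X \<nu>, the interaction radius h \<nu>, the considered point X \<nu> (i \<nu>) with its
   reconstruction function and its coefficients.  If \<nu> ranges over all pairs of a discretization and
   one of its points, the Landau constants are uniform in the points. *)

(* Smoothness of order r for a function v \<nu> that may depend on the discretization \<nu>, as the
   reconstruction functions do: v \<nu> is of class C^r, and its derivatives up to order r are bounded
   near the point y \<nu> independently of \<nu>.  Without the bound, no discrete operator would be
   consistent for all such v.  If v and y do not depend on \<nu>, the bound holds automatically. *)

definition smooth_family ::
    "'n filter \<Rightarrow> 'd::{finite,linorder} point set \<Rightarrow> ('n \<Rightarrow> 'd point) \<Rightarrow> nat \<Rightarrow>
     ('n \<Rightarrow> 'd point \<Rightarrow> real) \<Rightarrow> bool" where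
  "smooth_family F \<Omega> y r v \<longleftrightarrow>
     (\<forall>\<nu>. C_on r \<Omega> (v \<nu>)) \<and>
     (\<exists>\<rho>>0. \<exists>B. \<forall>\<^sub>F \<nu> in F. \<forall>\<beta>. mi_degree \<beta> \<le> r \<longrightarrow>
        (\<forall>x \<in> \<Omega> \<inter> cball (y \<nu>) \<rho>. \<bar>mi_deriv \<Omega> \<beta> (v \<nu>) x\<bar> \<le> B))"

(* Consistency of order p of the discrete Laplace operators with coefficients c \<nu> at the points
   X \<nu> (i \<nu>), for functions of smoothness order r. *)

definition laplace_consistent ::
    "'n filter \<Rightarrow> 'd::{finite,linorder} point set \<Rightarrow> ('n \<Rightarrow> nat) \<Rightarrow> ('n \<Rightarrow> nat \<Rightarrow> 'd point) \<Rightarrow>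
     ('n \<Rightarrow> 'd point \<Rightarrow> real) \<Rightarrow> ('n \<Rightarrow> nat) \<Rightarrow> ('n \<Rightarrow> nat \<Rightarrow> real) \<Rightarrow> nat \<Rightarrow> nat \<Rightarrow> bool" where
  "laplace_consistent F \<Omega> N X h i c r p \<longleftrightarrow>
     (\<forall>v. smooth_family F \<Omega> (\<lambda>\<nu>. X \<nu> (i \<nu>)) r v \<longrightarrow>
        (\<lambda>\<nu>. laplacian \<Omega> (v \<nu>) (X \<nu> (i \<nu>))
              - (\<Sum>j\<in>stencil (N \<nu>) (X \<nu>) (h \<nu>) (i \<nu>). c \<nu> j * v \<nu> (X \<nu> j)))
          \<in> O[F](\<lambda>\<nu>. h \<nu> (X \<nu> (i \<nu>)) ^ p))"

(* Moment of order \<alpha> of the derived diffusion operator. *)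

definition diffusion_moment ::
    "nat \<Rightarrow> (nat \<Rightarrow> real^'d) \<Rightarrow> (real^'d \<Rightarrow> real) \<Rightarrow> nat \<Rightarrow>
     (real^'d \<Rightarrow> real) \<Rightarrow> (nat \<Rightarrow> real) \<Rightarrow> 'd multi_index \<Rightarrow> real" where
  "diffusion_moment N X h i R c \<alpha> =
     (\<Sum>j\<in>stencil N X h i. diffusion_coeff N X h i R c j * mi_power (X j - X i) \<alpha>)"

end

theory Submission
  imports Defs
begin

text \<open>
  Test the discrete Laplace operator on \<open>v\<^sub>\<alpha> x = \<kappa>rec x * (x - x\<^sub>i)\<^sup>\<alpha>\<close>. For \<open>\<alpha> \<noteq> 0\<close> this
  function vanishes at \<open>x\<^sub>i\<close>, so the diagonal coefficient plays no role and the moment of order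
  \<open>\<alpha>\<close> of the diffusion operator is the discrete Laplacian of \<open>v\<^sub>\<alpha>\<close>. By the product rule
  \<open>\<Delta> v\<^sub>\<alpha> (x\<^sub>i)\<close> is \<open>2 \<partial>\<^sub>k \<kappa>rec (x\<^sub>i)\<close>, \<open>2 \<kappa>rec (x\<^sub>i)\<close> or \<open>0\<close>, and the reconstruction property
  concludes. Monomials are built up one linear factor at a time, which keeps the Leibniz rule for
  higher derivatives short and compatible with the fixed order of differentiation.
\<close>

section \<open>Partial derivatives on a closed domain and their boundary values\<close>

text \<open>A closed domain is the closure of an open set, so each of its boundary points is a limit
  point of the interior. The limit defining \<open>partial_deriv\<close> there is therefore unique,
  and continuity of \<open>g\<close> identifies it. Derivative formulas thus only have to be checked
  in the interior.\<close>

lemma partial_deriv_eqI: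
  assumes "closed_domain \<Omega>" and g: "continuous_on \<Omega> g" and x: "x \<in> \<Omega>"
    and D: "\<And>y. y \<in> interior \<Omega> \<Longrightarrow>
      ((\<lambda>t. f (y + t *\<^sub>R axis k 1)) has_real_derivative g y) (at 0)"
  shows "partial_deriv \<Omega> k f x = g x"
proof (cases "x \<in> interior \<Omega>")
  case True
  then show ?thesis
    using D by (simp add: partial_deriv_def DERIV_imp_deriv)
next
  case False
  obtain U where "open U" "\<Omega> = closure U"
    using assms(1) unfolding closed_domain_def by blast
  then have "U \<subseteq> interior \<Omega>"
    by (simp add: closure_subset interior_maximal)
  then have "x \<in> closure (interior \<Omega>)"
    using x closure_mono \<open>\<Omega> = closure U\<close> by blast
  then have "x islimpt interior \<Omega>"
    using False by (simp add: closure_def)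
  then have nt: "at x within interior \<Omega> \<noteq> bot"
    by (simp add: trivial_limit_within)
  have "(g \<longlongrightarrow> g x) (at x within interior \<Omega>)"
    using g x interior_subset tendsto_within_subset unfolding continuous_on_def by blast
  moreover have "\<forall>\<^sub>F y in at x within interior \<Omega>. g y = deriv (\<lambda>t. f (y + t *\<^sub>R axis k 1)) 0"
    unfolding eventually_at_filter by (intro always_eventually) (simp add: DERIV_imp_deriv[OF D])
  ultimately have "((\<lambda>y. deriv (\<lambda>t. f (y + t *\<^sub>R axis k 1)) 0) \<longlongrightarrow> g x) (at x within interior \<Omega>)"
    by (rule Lim_transform_eventually)
  then show ?thesis
    using nt False by (simp add: partial_deriv_def tendsto_Lim)
qed

lemma eventually_in_interior_line:
  fixes y :: "real^'d"
  assumes "y \<in> interior \<Omega>"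
  shows "\<forall>\<^sub>F t in nhds 0. y + t *\<^sub>R axis k 1 \<in> interior \<Omega>"
proof -
  have "((\<lambda>t. y + t *\<^sub>R axis k 1) \<longlongrightarrow> y + 0 *\<^sub>R axis k 1) (nhds (0::real))"
    by (intro tendsto_intros filterlim_ident)
  then show ?thesis
    using assms topological_tendstoD[OF _ open_interior] by fastforce
qed

text \<open>Near an interior point, coordinate lines stay in the interior, so only values on
  \<open>\<Omega>\<close> enter. The conclusion is an equality of functions on the whole space, so
  identities known only on \<open>\<Omega>\<close> can be substituted below a further
  \<open>partial_deriv\<close>.\<close>

lemma partial_deriv_cong:
  fixes f g :: "real^'d \<Rightarrow> real"
  assumes "\<And>x. x \<in> \<Omega> \<Longrightarrow> f x = g x"
  shows "partial_deriv \<Omega> k f = partial_deriv \<Omega> k g"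
proof
  fix x
  have D: "deriv (\<lambda>t. f (y + t *\<^sub>R axis k 1)) 0 = deriv (\<lambda>t. g (y + t *\<^sub>R axis k 1)) 0"
    if "y \<in> interior \<Omega>" for y
  proof (rule deriv_cong_ev)
    show "\<forall>\<^sub>F t in nhds 0. f (y + t *\<^sub>R axis k 1) = g (y + t *\<^sub>R axis k 1)"
      using eventually_in_interior_line[OF that]
      by (rule eventually_mono) (use assms interior_subset in blast)
  qed simp
  \<comment> \<open>\<open>Lim\<close> is a definite description, so this equivalence for every
    \<open>L\<close> equates the two values even where the limit fails to exist or to be
    unique.\<close>
  have "((\<lambda>y. deriv (\<lambda>t. f (y + t *\<^sub>R axis k 1)) 0) \<longlongrightarrow> L) (at x within interior \<Omega>) \<longleftrightarrow>
        ((\<lambda>y. deriv (\<lambda>t. g (y + t *\<^sub>R axis k 1)) 0) \<longlongrightarrow> L) (at x within interior \<Omega>)" for L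
    by (rule filterlim_cong) (auto simp: eventually_at_filter D)
  then show "partial_deriv \<Omega> k f x = partial_deriv \<Omega> k g x"
    using D by (simp add: partial_deriv_def t2_space_class.Lim_def)
qed

section \<open>The classes C^n: congruence, monotonicity, sums and products\<close>

text \<open>A single case split suffices: by \<open>partial_deriv_cong\<close> the partial
  derivatives of \<open>f\<close> and \<open>g\<close> are the same functions, so their smoothness
  transfers at once.\<close>

lemma C_on_cong:
  fixes f g :: "real^'d \<Rightarrow> real"
  assumes eq: "\<And>x. x \<in> \<Omega> \<Longrightarrow> f x = g x" and f: "C_on n \<Omega> f"
  shows "C_on n \<Omega> g"
proof (cases n)
  case 0
  then show ?thesis
    using f continuous_on_cong[of \<Omega> \<Omega> f g] eq by simp
next
  case (Suc m)
  have "(\<lambda>t. g (x + t *\<^sub>R axis k 1)) differentiable (at 0)" if x: "x \<in> interior \<Omega>" for x k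
  proof -
    obtain D where D: "((\<lambda>t. f (x + t *\<^sub>R axis k 1)) has_real_derivative D) (at 0)"
      using f Suc x by (auto simp: real_differentiable_def)
    have ev: "\<forall>\<^sub>F t in nhds 0. f (x + t *\<^sub>R axis k 1) = g (x + t *\<^sub>R axis k 1)"
      using eventually_in_interior_line[OF x]
      by (rule eventually_mono) (use eq interior_subset in blast)
    have "((\<lambda>t. g (x + t *\<^sub>R axis k 1)) has_real_derivative D) (at 0)"
      by (rule iffD1[OF DERIV_cong_ev[OF refl ev refl] D])
    then show ?thesis
      by (auto simp: real_differentiable_def)
  qed
  moreover have "continuous_on \<Omega> g"
    using f Suc continuous_on_cong[of \<Omega> \<Omega> f g] eq by simp
  moreover have "partial_deriv \<Omega> k f = partial_deriv \<Omega> k g" for k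
    by (rule partial_deriv_cong) (rule eq)
  ultimately show ?thesis
    using f Suc by simp
qed

lemma C_on_imp_continuous_on: "C_on n \<Omega> f \<Longrightarrow> continuous_on \<Omega> f"
  by (cases n) auto

lemma C_on_SucD: "C_on (Suc n) \<Omega> f \<Longrightarrow> C_on n \<Omega> f"
  by (induction n arbitrary: f) (simp, force)

lemma C_on_mono: "m \<le> n \<Longrightarrow> C_on n \<Omega> f \<Longrightarrow> C_on m \<Omega> f"
  by (induction n rule: dec_induct) (auto simp del: C_on.simps dest: C_on_SucD)

lemma C_on_partial_deriv: "C_on (Suc n) \<Omega> f \<Longrightarrow> C_on n \<Omega> (partial_deriv \<Omega> k f)"
  by simp

lemma has_partial_deriv:
  assumes "C_on (Suc n) \<Omega> f" "x \<in> interior \<Omega>"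
  shows "((\<lambda>t. f (x + t *\<^sub>R axis k 1)) has_real_derivative partial_deriv \<Omega> k f x) (at 0)"
  using assms by (auto simp: partial_deriv_def DERIV_deriv_iff_real_differentiable)

text \<open>Replaces the partial derivatives in \<open>C_on\<close> by explicit candidates
  \<open>g k\<close> verified in the interior. This lets the inductions for sums and products run on
  the formulas of calculus.\<close>

lemma C_on_SucI:
  assumes dom: "closed_domain \<Omega>" and f: "continuous_on \<Omega> f"
    and g: "\<And>k. C_on n \<Omega> (g k)"
    and D: "\<And>k y. y \<in> interior \<Omega> \<Longrightarrow>
      ((\<lambda>t. f (y + t *\<^sub>R axis k 1)) has_real_derivative g k y) (at 0)"
  shows "C_on (Suc n) \<Omega> f"
proof -
  have "C_on n \<Omega> (partial_deriv \<Omega> k f)" for k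
    using C_on_cong[OF _ g] partial_deriv_eqI[OF dom C_on_imp_continuous_on[OF g] _ D]
    by metis
  then show ?thesis
    using f D by (auto simp: real_differentiable_def)
qed

lemma has_derivative_line_mult:
  assumes "C_on (Suc n) \<Omega> f" "C_on (Suc n) \<Omega> g" "y \<in> interior \<Omega>"
  shows "((\<lambda>t. f (y + t *\<^sub>R axis k 1) * g (y + t *\<^sub>R axis k 1)) has_real_derivative
      partial_deriv \<Omega> k f y * g y + f y * partial_deriv \<Omega> k g y) (at 0)"
  using DERIV_mult[OF has_partial_deriv[OF assms(1,3)] has_partial_deriv[OF assms(2,3)], of k k]
  by (simp add: mult.commute)

lemma has_derivative_line_add:
  assumes "C_on (Suc n) \<Omega> f" "C_on (Suc n) \<Omega> g" "y \<in> interior \<Omega>"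
  shows "((\<lambda>t. f (y + t *\<^sub>R axis k 1) + g (y + t *\<^sub>R axis k 1)) has_real_derivative
      partial_deriv \<Omega> k f y + partial_deriv \<Omega> k g y) (at 0)"
  using DERIV_add[OF has_partial_deriv[OF assms(1,3)] has_partial_deriv[OF assms(2,3)], of k k]
  by simp

lemma C_on_add:
  assumes "closed_domain \<Omega>" "C_on n \<Omega> f" "C_on n \<Omega> g"
  shows "C_on n \<Omega> (\<lambda>x. f x + g x)"
  using assms(2,3)
proof (induction n arbitrary: f g)
  case 0
  then show ?case by (simp add: continuous_on_add)
next
  case (Suc n)
  show ?case
    by (rule C_on_SucI[OF assms(1) _ Suc.IH has_derivative_line_add[OF Suc.prems]])
      (use Suc.prems in \<open>auto intro: continuous_on_add\<close>)
qed

lemma C_on_mult: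
  assumes "closed_domain \<Omega>" "C_on n \<Omega> f" "C_on n \<Omega> g"
  shows "C_on n \<Omega> (\<lambda>x. f x * g x)"
  using assms(2,3)
proof (induction n arbitrary: f g)
  case 0
  then show ?case by (simp add: continuous_on_mult)
next
  case (Suc n)
  show ?case
  proof (rule C_on_SucI[OF assms(1) _ _ has_derivative_line_mult[OF Suc.prems]])
    show "continuous_on \<Omega> (\<lambda>x. f x * g x)"
      using Suc.prems by (auto intro: continuous_on_mult)
    show "C_on n \<Omega> (\<lambda>y. partial_deriv \<Omega> k f y * g y + f y * partial_deriv \<Omega> k g y)" for k
      by (rule C_on_add[OF assms(1)
            Suc.IH[OF C_on_partial_deriv[OF Suc.prems(1)] C_on_SucD[OF Suc.prems(2)]]
            Suc.IH[OF C_on_SucD[OF Suc.prems(1)] C_on_partial_deriv[OF Suc.prems(2)]]])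
  qed
qed

lemma C_on_const:
  assumes "closed_domain \<Omega>"
  shows "C_on n \<Omega> (\<lambda>_. a)"
proof (induction n arbitrary: a)
  case (Suc n)
  show ?case
    by (rule C_on_SucI[OF assms _ Suc.IH[of 0]]) auto
qed simp

lemma has_derivative_line_coord:
  fixes y :: "real^'d"
  shows "((\<lambda>t. (y + t *\<^sub>R axis k 1) $ l - a) has_real_derivative of_bool (k = l)) (at 0)"
  by (auto simp: axis_def intro!: derivative_eq_intros)

lemma C_on_coord:
  fixes \<Omega> :: "(real^'d) set"
  assumes "closed_domain \<Omega>"
  shows "C_on n \<Omega> (\<lambda>x. x $ l - a)"
proof -
  have "continuous_on \<Omega> (\<lambda>x. x $ l - a)"
    by (intro continuous_intros)
  \<comment> \<open>The derivative is constant, hence of class C^n for every n; aiming one order too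
    high avoids a separate case for order 0.\<close>
  then have "C_on (Suc n) \<Omega> (\<lambda>x. x $ l - a)"
    by (rule C_on_SucI[OF assms _ C_on_const[OF assms] has_derivative_line_coord])
  then show ?thesis
    by (rule C_on_SucD)
qed

section \<open>Product rules for partial derivatives and the Laplacian\<close>

lemma partial_deriv_coord:
  assumes "closed_domain \<Omega>" "x \<in> \<Omega>"
  shows "partial_deriv \<Omega> k (\<lambda>x. x $ l - a) x = of_bool (k = l)"
  by (rule partial_deriv_eqI[OF assms(1) continuous_on_const assms(2) has_derivative_line_coord])

lemma partial_deriv_const:
  assumes "closed_domain \<Omega>" "x \<in> \<Omega>"
  shows "partial_deriv \<Omega> k (\<lambda>_. a) x = 0"
  by (rule partial_deriv_eqI[OF assms(1) continuous_on_const assms(2)]) simp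

lemma partial_deriv_add:
  assumes "closed_domain \<Omega>" "C_on 1 \<Omega> f" "C_on 1 \<Omega> g" "x \<in> \<Omega>"
  shows "partial_deriv \<Omega> k (\<lambda>x. f x + g x) x = partial_deriv \<Omega> k f x + partial_deriv \<Omega> k g x"
proof (rule partial_deriv_eqI[OF assms(1) _ assms(4) has_derivative_line_add])
  show "C_on (Suc 0) \<Omega> f" "C_on (Suc 0) \<Omega> g"
    using assms by simp_all
  then show "continuous_on \<Omega> (\<lambda>x. partial_deriv \<Omega> k f x + partial_deriv \<Omega> k g x)"
    by (intro continuous_on_add) auto
qed

lemma partial_deriv_mult:
  assumes "closed_domain \<Omega>" "C_on 1 \<Omega> f" "C_on 1 \<Omega> g" "x \<in> \<Omega>"
  shows "partial_deriv \<Omega> k (\<lambda>x. f x * g x) x =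
    partial_deriv \<Omega> k f x * g x + f x * partial_deriv \<Omega> k g x"
proof (rule partial_deriv_eqI[OF assms(1) _ assms(4) has_derivative_line_mult])
  show "C_on (Suc 0) \<Omega> f" "C_on (Suc 0) \<Omega> g"
    using assms by simp_all
  then show "continuous_on \<Omega> (\<lambda>x. partial_deriv \<Omega> k f x * g x + f x * partial_deriv \<Omega> k g x)"
    by (intro continuous_on_add continuous_on_mult) auto
qed

lemma partial_deriv_coord_mult:
  assumes "closed_domain \<Omega>" "C_on 1 \<Omega> f" "x \<in> \<Omega>"
  shows "partial_deriv \<Omega> k (\<lambda>x. (x $ l - a) * f x) x =
    of_bool (k = l) * f x + (x $ l - a) * partial_deriv \<Omega> k f x"
  using partial_deriv_mult[OF assms(1) C_on_coord[OF assms(1)] assms(2,3)]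
    partial_deriv_coord[OF assms(1,3)] by simp

text \<open>The second derivatives of a linear factor vanish, so besides the multiplied Laplacian
  only the cross term in direction \<open>l\<close> remains. At a point with
  \<open>x $ l = a\<close> this reduces a Laplacian to a first derivative.\<close>

lemma laplacian_coord_mult:
  assumes dom: "closed_domain \<Omega>" and f: "C_on 2 \<Omega> f" and x: "x \<in> \<Omega>"
  shows "laplacian \<Omega> (\<lambda>x. (x $ l - a) * f x) x =
    2 * partial_deriv \<Omega> l f x + (x $ l - a) * laplacian \<Omega> f x"
proof -
  have f1: "C_on 1 \<Omega> f"
    by (rule C_on_mono[OF _ f]) simp
  have f2: "C_on 1 \<Omega> (partial_deriv \<Omega> k f)" for k
    using f by (intro C_on_partial_deriv) (simp add: numeral_2_eq_2)
  have "partial_deriv \<Omega> k (partial_deriv \<Omega> k (\<lambda>x. (x $ l - a) * f x)) x =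
    (if k = l then 2 * partial_deriv \<Omega> k f x else 0) +
    (x $ l - a) * partial_deriv \<Omega> k (partial_deriv \<Omega> k f) x" for k
  proof -
    \<comment> \<open>The inner product rule holds on \<open>\<Omega>\<close> only, hence the
      passage through \<open>partial_deriv_cong\<close>.\<close>
    have "partial_deriv \<Omega> k (partial_deriv \<Omega> k (\<lambda>x. (x $ l - a) * f x)) x =
      partial_deriv \<Omega> k (\<lambda>x. of_bool (k = l) * f x + (x $ l - a) * partial_deriv \<Omega> k f x) x"
      by (rule fun_cong[OF partial_deriv_cong]) (rule partial_deriv_coord_mult[OF dom f1])
    also have "\<dots> = partial_deriv \<Omega> k (\<lambda>x. of_bool (k = l) * f x) x +
        partial_deriv \<Omega> k (\<lambda>x. (x $ l - a) * partial_deriv \<Omega> k f x) x"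
      by (intro partial_deriv_add C_on_mult C_on_const C_on_coord dom f1 f2 x)
    also have "\<dots> = of_bool (k = l) * partial_deriv \<Omega> k f x + (of_bool (k = l) * partial_deriv \<Omega> k f x +
        (x $ l - a) * partial_deriv \<Omega> k (partial_deriv \<Omega> k f) x)"
      by (simp add: partial_deriv_coord_mult[OF dom f2 x] partial_deriv_const[OF dom x]
          partial_deriv_mult[OF dom C_on_const[OF dom] f1 x])
    finally show ?thesis
      by simp
  qed
  then show ?thesis
    by (simp add: laplacian_def sum.distrib sum_distrib_left)
qed

section \<open>Higher derivatives as sorted words of coordinates, and their Leibniz rule\<close>

text \<open>Spelling a multi-index as a list turns the nested iterates of \<open>mi_deriv\<close>
  into one fold, open to list induction; lowering an exponent becomes
  \<open>remove1\<close>.\<close>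

definition mi_word :: "'d::{finite,linorder} multi_index \<Rightarrow> 'd list" where
  "mi_word \<alpha> = concat (map (\<lambda>k. replicate (\<alpha> k) k) (sorted_list_of_set UNIV))"

lemma mi_deriv_eq_foldr: "mi_deriv \<Omega> \<alpha> f = foldr (partial_deriv \<Omega>) (mi_word \<alpha>) f"
proof -
  have "foldr g (replicate n k) u = (g k ^^ n) u" for g :: "'a \<Rightarrow> 'b \<Rightarrow> 'b" and n k u
    by (induction n) auto
  then have "foldr (\<lambda>k. partial_deriv \<Omega> k ^^ \<alpha> k) ks f =
      foldr (partial_deriv \<Omega>) (concat (map (\<lambda>k. replicate (\<alpha> k) k) ks)) f" for ks
    by (induction ks) auto
  then show ?thesis
    by (simp add: mi_deriv_def mi_word_def)
qed

lemma count_list_mi_word: "count_list (mi_word \<alpha>) k = \<alpha> k"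
proof -
  have "count_list (replicate n l) k = (if k = l then n else 0)" for n and l :: 'a
    by (induction n) auto
  then have "count_list (concat (map (\<lambda>k. replicate (\<alpha> k) k) ks)) k = (if k \<in> set ks then \<alpha> k else 0)"
    if "distinct ks" for ks
    using that by (induction ks) auto
  then show ?thesis
    by (simp add: mi_word_def)
qed

lemma sorted_mi_word: "sorted (mi_word \<alpha>)"
proof -
  have "sorted (concat (map (\<lambda>k. replicate (\<alpha> k) k) ks))" if "sorted ks" for ks
    using that by (induction ks) (auto simp: sorted_append)
  then show ?thesis
    by (simp add: mi_word_def)
qed

lemma length_mi_word: "length (mi_word \<alpha>) = mi_degree \<alpha>"
  by (simp add: mi_word_def mi_degree_def length_concat comp_def sum_list_distinct_conv_sum_set)

text \<open>Sorted lists with equal multisets coincide. Hence \<open>mi_word\<close> and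
  \<open>count_list\<close> are mutually inverse, and a word shortened by \<open>remove1\<close> can
  be read as a multi-index again.\<close>

lemma mi_word_count_list:
  assumes "sorted w"
  shows "mi_word (count_list w) = w"
proof -
  have "mset (mi_word (count_list w)) = mset w"
    by (rule multiset_eqI) (simp add: count_mset count_list_mi_word)
  then show ?thesis
    using assms sorted_mi_word properties_for_sort by metis
qed

lemma mi_deriv_zero: "mi_deriv \<Omega> (\<lambda>_. 0) f = f"
proof -
  have "mi_word (\<lambda>_. 0) = ([] :: 'a list)"
    using length_mi_word[of "\<lambda>_. 0"] by (simp add: mi_degree_def)
  then show ?thesis
    by (simp add: mi_deriv_eq_foldr)
qed

lemma mi_deriv_unit: "mi_deriv \<Omega> (mi_unit k) f = partial_deriv \<Omega> k f"
proof -
  have "mi_unit k = count_list [k]"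
    by (auto simp: mi_unit_def)
  then show ?thesis
    using mi_word_count_list[of "[k]"] by (simp add: mi_deriv_eq_foldr)
qed

lemma C_on_foldr:
  assumes "C_on (m + length w) \<Omega> f"
  shows "C_on m \<Omega> (foldr (partial_deriv \<Omega>) w f)"
  using assms
proof (induction w arbitrary: m)
  case (Cons k w)
  then show ?case
    using C_on_partial_deriv[OF Cons.IH[of "Suc m"]] by simp
qed simp

text \<open>Sortedness makes equal entries of \<open>w\<close> adjacent, so that removing any one of the occurrences
  of \<open>l\<close> gives the same word and no exchange of partial derivatives is needed.\<close>

lemma foldr_partial_deriv_coord_mult:
  assumes dom: "closed_domain \<Omega>" and f: "C_on n \<Omega> f"
    and "length w \<le> n" "sorted w" "x \<in> \<Omega>"
  shows "foldr (partial_deriv \<Omega>) w (\<lambda>x. (x $ l - a) * f x) x =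
    (x $ l - a) * foldr (partial_deriv \<Omega>) w f x +
    real (count_list w l) * foldr (partial_deriv \<Omega>) (remove1 l w) f x"
  using assms(3-)
proof (induction w arbitrary: x)
  case (Cons k w)
  let ?D = "foldr (partial_deriv \<Omega>)"
  \<comment> \<open>Here \<open>length w + 1 \<le> n\<close>, so after at most
    \<open>length w\<close> derivatives one order of smoothness is left for the product
    rule.\<close>
  have C1: "C_on 1 \<Omega> (?D u f)" if "length u \<le> length w" for u
    using that Cons.prems by (intro C_on_foldr C_on_mono[OF _ f]) simp
  have Cw: "C_on 1 \<Omega> (?D w f)" "C_on 1 \<Omega> (?D (remove1 l w) f)"
    using C1 by (auto simp: length_remove1)
  have "partial_deriv \<Omega> k (?D w (\<lambda>x. (x $ l - a) * f x)) x =
      partial_deriv \<Omega> k (\<lambda>x. (x $ l - a) * ?D w f x + real (count_list w l) * ?D (remove1 l w) f x) x"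
    by (rule fun_cong[OF partial_deriv_cong], rule Cons.IH) (use Cons.prems in auto)
  also have "\<dots> = partial_deriv \<Omega> k (\<lambda>x. (x $ l - a) * ?D w f x) x +
      partial_deriv \<Omega> k (\<lambda>x. real (count_list w l) * ?D (remove1 l w) f x) x"
    by (intro partial_deriv_add C_on_mult C_on_const C_on_coord dom Cw Cons.prems)
  also have "\<dots> = of_bool (k = l) * ?D w f x + (x $ l - a) * ?D (k # w) f x +
      real (count_list w l) * ?D (k # remove1 l w) f x"
    by (simp add: partial_deriv_coord_mult[OF dom Cw(1) Cons.prems(3)]
        partial_deriv_const[OF dom Cons.prems(3)]
        partial_deriv_mult[OF dom C_on_const[OF dom] Cw(2) Cons.prems(3)])
  finally have eq: "?D (k # w) (\<lambda>x. (x $ l - a) * f x) x = \<dots>"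
    by simp
  show ?case
  proof (cases "k = l")
    case True
    have "l # remove1 l w = w" if "l \<in> set w"
      using that True Cons.prems(2) by (cases w) fastforce+
    then have "real (count_list w l) * ?D (k # remove1 l w) f x = real (count_list w l) * ?D w f x"
      using True by (cases "l \<in> set w") (metis, simp)
    then show ?thesis
      unfolding eq using True by (simp add: algebra_simps)
  next
    case False
    then show ?thesis
      unfolding eq by simp
  qed
qed simp

text \<open>Leibniz rule with a linear factor, of which only the first derivative in direction
  \<open>l\<close> survives. The \<open>count_list\<close> term is \<open>\<beta>\<close> with entry
  \<open>l\<close> lowered by one; if that entry is 0, the prefactor removes the term.\<close>

lemma mi_deriv_coord_mult:
  assumes dom: "closed_domain \<Omega>" and f: "C_on n \<Omega> f"
    and "mi_degree \<beta> \<le> n" "x \<in> \<Omega>"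
  shows "mi_deriv \<Omega> \<beta> (\<lambda>x. (x $ l - a) * f x) x =
    (x $ l - a) * mi_deriv \<Omega> \<beta> f x +
    real (\<beta> l) * mi_deriv \<Omega> (count_list (remove1 l (mi_word \<beta>))) f x"
  using foldr_partial_deriv_coord_mult[OF dom f _ sorted_mi_word assms(4), of \<beta> l a] assms(3)
  by (simp add: mi_deriv_eq_foldr count_list_mi_word length_mi_word mi_word_count_list
      sorted_remove1 sorted_mi_word)

section \<open>Smooth families and centred monomials\<close>

text \<open>The linear factor is centred at the moving point \<open>y \<nu>\<close>, so on the ball
  of radius \<open>\<rho>\<close> it is bounded by \<open>\<rho>\<close>, whatever
  \<open>\<nu>\<close> is. The Leibniz rule then keeps all bounds independent of
  \<open>\<nu>\<close>.\<close>

lemma smooth_family_coord_mult: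
  fixes \<Omega> :: "'d::{finite,linorder} point set"
  assumes dom: "closed_domain \<Omega>" and v: "smooth_family F \<Omega> y r v"
  shows "smooth_family F \<Omega> y r (\<lambda>\<nu> x. (x $ l - y \<nu> $ l) * v \<nu> x)"
proof -
  have C: "C_on r \<Omega> (v \<nu>)" for \<nu>
    using v by (simp add: smooth_family_def)
  obtain \<rho> B where \<rho>: "\<rho> > 0" and ev: "\<forall>\<^sub>F \<nu> in F. \<forall>\<beta>. mi_degree \<beta> \<le> r \<longrightarrow>
      (\<forall>x \<in> \<Omega> \<inter> cball (y \<nu>) \<rho>. \<bar>mi_deriv \<Omega> \<beta> (v \<nu>) x\<bar> \<le> B)"
    using v by (auto simp: smooth_family_def)
  \<comment> \<open>The two summands of the bound belong to the two Leibniz terms; \<open>r\<close>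
    comes from \<open>\<beta> l \<le> mi_degree \<beta> \<le> r\<close>.\<close>
  have "\<forall>\<^sub>F \<nu> in F. \<forall>\<beta>. mi_degree \<beta> \<le> r \<longrightarrow> (\<forall>x \<in> \<Omega> \<inter> cball (y \<nu>) \<rho>.
      \<bar>mi_deriv \<Omega> \<beta> (\<lambda>x. (x $ l - y \<nu> $ l) * v \<nu> x) x\<bar> \<le> \<rho> * B + real r * B)"
    using ev
  proof (rule eventually_mono, intro allI impI ballI)
    fix \<nu> and \<beta> :: "'d multi_index" and x
    assume B: "\<forall>\<beta>. mi_degree \<beta> \<le> r \<longrightarrow>
        (\<forall>x \<in> \<Omega> \<inter> cball (y \<nu>) \<rho>. \<bar>mi_deriv \<Omega> \<beta> (v \<nu>) x\<bar> \<le> B)"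
      and \<beta>: "mi_degree \<beta> \<le> r" and x: "x \<in> \<Omega> \<inter> cball (y \<nu>) \<rho>"
    let ?\<gamma> = "count_list (remove1 l (mi_word \<beta>))"
    have "mi_degree ?\<gamma> = length (remove1 l (mi_word \<beta>))"
      by (metis length_mi_word mi_word_count_list sorted_remove1 sorted_mi_word)
    then have \<gamma>: "mi_degree ?\<gamma> \<le> r"
      using \<beta> by (simp add: length_remove1 length_mi_word) arith
    have "\<beta> l \<le> mi_degree \<beta>"
      unfolding mi_degree_def by (rule member_le_sum) auto
    then have 1: "real (\<beta> l) * \<bar>mi_deriv \<Omega> ?\<gamma> (v \<nu>) x\<bar> \<le> real r * B"
      using B \<gamma> x \<beta> by (intro mult_mono) auto
    have "\<bar>x $ l - y \<nu> $ l\<bar> \<le> norm (x - y \<nu>)"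
      using component_le_norm_cart[of "x - y \<nu>" l] by simp
    also have "\<dots> \<le> \<rho>"
      using x by (simp add: dist_norm norm_minus_commute)
    finally have 2: "\<bar>x $ l - y \<nu> $ l\<bar> * \<bar>mi_deriv \<Omega> \<beta> (v \<nu>) x\<bar> \<le> \<rho> * B"
      using B \<beta> x \<rho> by (intro mult_mono) auto
    have "mi_deriv \<Omega> \<beta> (\<lambda>x. (x $ l - y \<nu> $ l) * v \<nu> x) x =
        (x $ l - y \<nu> $ l) * mi_deriv \<Omega> \<beta> (v \<nu>) x + real (\<beta> l) * mi_deriv \<Omega> ?\<gamma> (v \<nu>) x"
      using x by (intro mi_deriv_coord_mult[OF dom C \<beta>]) simp
    also have "\<bar>\<dots>\<bar> \<le> \<bar>x $ l - y \<nu> $ l\<bar> * \<bar>mi_deriv \<Omega> \<beta> (v \<nu>) x\<bar> +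
        real (\<beta> l) * \<bar>mi_deriv \<Omega> ?\<gamma> (v \<nu>) x\<bar>"
      by (rule order_trans[OF abs_triangle_ineq]) (simp add: abs_mult)
    finally show "\<bar>mi_deriv \<Omega> \<beta> (\<lambda>x. (x $ l - y \<nu> $ l) * v \<nu> x) x\<bar> \<le> \<rho> * B + real r * B"
      using 1 2 by linarith
  qed
  then show ?thesis
    unfolding smooth_family_def using \<rho> C_on_mult[OF dom C_on_coord[OF dom] C] by blast
qed

lemma mi_power_zero: "mi_power x (\<lambda>_. 0) = 1"
  by (simp add: mi_power_def)

lemma mi_power_mult_coord:
  assumes "0 < \<alpha> l"
  shows "mi_power x \<alpha> = x $ l * mi_power x (\<alpha>(l := \<alpha> l - 1))"
proof -
  have "(\<Prod>k\<in>UNIV - {l}. (x $ k) ^ (\<alpha>(l := \<alpha> l - 1)) k) = (\<Prod>k\<in>UNIV - {l}. (x $ k) ^ \<alpha> k)"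
    by (rule prod.cong) auto
  moreover have "(x $ l) ^ \<alpha> l = x $ l * (x $ l) ^ (\<alpha> l - 1)"
    using assms by (simp add: power_eq_if)
  ultimately show ?thesis
    unfolding mi_power_def by (subst (1 2) prod.remove[of _ l]) simp_all
qed

lemma mi_power_origin: "mi_power 0 \<alpha> = of_bool (\<alpha> = (\<lambda>_. 0))"
proof (cases "\<alpha> = (\<lambda>_. 0)")
  case False
  then obtain l where "0 < \<alpha> l"
    by fastforce
  then show ?thesis
    using False mi_power_mult_coord[of \<alpha> l 0] by simp
qed (simp add: mi_power_zero)

lemma mi_unit_eq_upd: "mi_unit l = (\<lambda>_. 0)(l := Suc 0)"
  by (auto simp: mi_unit_def)

text \<open>Moves a decrement to the other side as an increment, so that the cases for
  \<open>\<alpha>\<close> translate into cases for the monomial left after splitting off one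
  factor.\<close>

lemma mi_decr_eq_iff:
  fixes \<alpha> :: "'d multi_index"
  assumes "0 < \<alpha> l"
  shows "\<alpha>(l := \<alpha> l - 1) = \<beta> \<longleftrightarrow> \<alpha> = \<beta>(l := Suc (\<beta> l))"
  using assms by auto

lemma mi_degree_decr:
  assumes "0 < \<alpha> l"
  shows "mi_degree (\<alpha>(l := \<alpha> l - 1)) < mi_degree \<alpha>"
  unfolding mi_degree_def by (rule sum_strict_mono_ex1) (use assms in auto)

text \<open>Makes the products of \<open>\<kappa>rec\<close> with centred monomials admissible test
  families for \<open>laplace_consistent\<close>, at the same order \<open>r\<close>.\<close>

lemma smooth_family_mi_power:
  assumes dom: "closed_domain \<Omega>" and v: "smooth_family F \<Omega> y r v"
  shows "smooth_family F \<Omega> y r (\<lambda>\<nu> x. mi_power (x - y \<nu>) \<alpha> * v \<nu> x)"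
proof (induction "mi_degree \<alpha>" arbitrary: \<alpha> rule: less_induct)
  case less
  show ?case
  proof (cases "\<alpha> = (\<lambda>_. 0)")
    case True
    then show ?thesis
      using v by (simp add: mi_power_zero)
  next
    case False
    then obtain l where "0 < \<alpha> l"
      by fastforce
    then show ?thesis
      using smooth_family_coord_mult[OF dom less[OF mi_degree_decr], of l l]
      by (simp add: mi_power_mult_coord[of \<alpha> l] mult.assoc)
  qed
qed

lemma C_on_mi_power:
  assumes dom: "closed_domain \<Omega>" and f: "C_on n \<Omega> f"
  shows "C_on n \<Omega> (\<lambda>x. mi_power (x - y) \<alpha> * f x)"
proof (induction "mi_degree \<alpha>" arbitrary: \<alpha> rule: less_induct)
  case less
  show ?case
  proof (cases "\<alpha> = (\<lambda>_. 0)")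
    case True
    then show ?thesis
      using f by (simp add: mi_power_zero)
  next
    case False
    then obtain l where "0 < \<alpha> l"
      by fastforce
    then show ?thesis
      using C_on_mult[OF dom C_on_coord[OF dom, of n l "y $ l"] less[OF mi_degree_decr], of l]
      by (simp add: mi_power_mult_coord[of \<alpha> l] mult.assoc)
  qed
qed

text \<open>Split off a factor \<open>x $ l - y $ l\<close>. It vanishes at \<open>y\<close>, so the
  derivative must hit it, and the remaining monomial is nonzero at \<open>y\<close> only if it is
  constant.\<close>

lemma partial_deriv_mi_power:
  assumes dom: "closed_domain \<Omega>" and f: "C_on 1 \<Omega> f" and y: "y \<in> \<Omega>" and "\<alpha> \<noteq> (\<lambda>_. 0)"
  shows "partial_deriv \<Omega> k (\<lambda>x. mi_power (x - y) \<alpha> * f x) y = of_bool (\<alpha> = mi_unit k) * f y"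
proof -
  obtain l where l: "0 < \<alpha> l"
    using assms(4) by fastforce
  have "\<alpha> = mi_unit k \<Longrightarrow> k = l"
    using l by (simp add: mi_unit_def split: if_splits)
  then have "\<alpha> = mi_unit k \<longleftrightarrow> k = l \<and> \<alpha>(l := \<alpha> l - 1) = (\<lambda>_. 0)"
    unfolding mi_decr_eq_iff[of \<alpha> l, OF l] mi_unit_eq_upd by auto
  then show ?thesis
    using partial_deriv_coord_mult[OF dom C_on_mi_power[OF dom f] y, of k l "y $ l" y "\<alpha>(l := \<alpha> l - 1)"]
    by (simp add: mi_power_mult_coord[of \<alpha> l, OF l] mi_power_origin mult.assoc)
qed

text \<open>After splitting off a factor in direction \<open>l\<close>, the Laplacian at
  \<open>y\<close> is twice the \<open>l\<close>-derivative of the remaining product. That remainder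
  is \<open>f\<close> itself for \<open>mi_unit l\<close>, and \<open>partial_deriv_mi_power\<close>
  evaluates every other case. As \<open>0 < \<alpha> l\<close>, no unit index of another direction
  can occur.\<close>

lemma laplacian_mi_power:
  assumes dom: "closed_domain \<Omega>" and f: "C_on 2 \<Omega> f" and y: "y \<in> \<Omega>" and l: "0 < \<alpha> l"
  shows "laplacian \<Omega> (\<lambda>x. mi_power (x - y) \<alpha> * f x) y =
    (if \<alpha> = mi_unit l then 2 * partial_deriv \<Omega> l f y
     else if \<alpha> = (\<lambda>k. 2 * mi_unit l k) then 2 * f y else 0)"
proof -
  let ?\<beta> = "\<alpha>(l := \<alpha> l - 1)"
  have "(\<lambda>k. 2 * mi_unit l k) = (mi_unit l)(l := Suc (mi_unit l l))"
    by (auto simp: mi_unit_def)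
  then have \<beta>: "\<alpha> = mi_unit l \<longleftrightarrow> ?\<beta> = (\<lambda>_. 0)"
      "\<alpha> = (\<lambda>k. 2 * mi_unit l k) \<longleftrightarrow> ?\<beta> = mi_unit l"
    unfolding mi_decr_eq_iff[of \<alpha> l, OF l] by (simp_all add: mi_unit_eq_upd)
  have ne: "mi_unit l \<noteq> (\<lambda>_. 0)"
    by (auto simp: mi_unit_def fun_eq_iff)
  have f1: "C_on 1 \<Omega> f"
    by (rule C_on_mono[OF _ f]) simp
  have "laplacian \<Omega> (\<lambda>x. mi_power (x - y) \<alpha> * f x) y =
      2 * partial_deriv \<Omega> l (\<lambda>x. mi_power (x - y) ?\<beta> * f x) y"
    using laplacian_coord_mult[OF dom C_on_mi_power[OF dom f] y, of l "y $ l" y ?\<beta>]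
    by (simp add: mi_power_mult_coord[of \<alpha> l, OF l] mult.assoc)
  then show ?thesis
    unfolding \<beta> using partial_deriv_mi_power[OF dom f1 y, of ?\<beta> l] ne
    by (auto simp: mi_power_zero)
qed

section \<open>Moments of the derived diffusion operator\<close>

text \<open>The diagonal coefficient is minus the sum of the others; membership of \<open>i\<close>
  in its stencil ensures that it is among the summands.\<close>

lemma diffusion_moment_zero:
  assumes "i \<in> stencil N X h i"
  shows "diffusion_moment N X h i R c (\<lambda>_. 0) = 0"
proof -
  have "finite (stencil N X h i)"
    by (simp add: stencil_def)
  then have "diffusion_moment N X h i R c (\<lambda>_. 0) =
      diffusion_coeff N X h i R c i + (\<Sum>j\<in>neighbors N X h i. diffusion_coeff N X h i R c j)"
    using assms by (simp add: diffusion_moment_def mi_power_zero neighbors_def sum.remove)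
  also have "(\<Sum>j\<in>neighbors N X h i. diffusion_coeff N X h i R c j) =
      (\<Sum>j\<in>neighbors N X h i. R (X j) * c j)"
    by (rule sum.cong) (auto simp: diffusion_coeff_def neighbors_def)
  finally show ?thesis
    by (simp add: diffusion_coeff_def)
qed

text \<open>The coefficients of the two sums can differ only at \<open>j = i\<close>, where the
  monomial is 0 by \<open>mi_power_origin\<close>.\<close>

lemma diffusion_moment_eq_discrete_laplacian:
  assumes "\<alpha> \<noteq> (\<lambda>_. 0)"
  shows "diffusion_moment N X h i R c \<alpha> =
    (\<Sum>j\<in>stencil N X h i. c j * (mi_power (X j - X i) \<alpha> * R (X j)))"
  unfolding diffusion_moment_def
  by (rule sum.cong) (use assms in \<open>auto simp: diffusion_coeff_def mi_power_origin\<close>)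

theorem theorem3p4:
  fixes \<Omega> :: "'d::{finite,linorder} point set"
    and \<kappa> :: "'d point \<Rightarrow> real"
    and \<kappa>min \<kappa>max :: real
    and F :: "'n filter"
    and N :: "'n \<Rightarrow> nat"
    and X :: "'n \<Rightarrow> nat \<Rightarrow> 'd point"
    and h :: "'n \<Rightarrow> 'd point \<Rightarrow> real"
    and i :: "'n \<Rightarrow> nat"
    and \<kappa>rec :: "'n \<Rightarrow> 'd point \<Rightarrow> real"
    and c :: "'n \<Rightarrow> nat \<Rightarrow> real"
    and p q r :: nat
  assumes domain: "closed_domain \<Omega>"
    and kappa_bounds: "0 < \<kappa>min" "\<And>x. x \<in> \<Omega> \<Longrightarrow> \<kappa>min < \<kappa> x \<and> \<kappa> x < \<kappa>max"
    and cloud: "\<And>\<nu>. point_cloud \<Omega> (N \<nu>) (X \<nu>)"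
    and index: "\<And>\<nu>. i \<nu> \<in> {1..N \<nu>}"
    and h_pos: "\<And>\<nu> x. x \<in> \<Omega> \<Longrightarrow> 0 < h \<nu> x"
    and h_lim: "uniform_limit \<Omega> h (\<lambda>_. 0) F"
    and p: "1 \<le> p" and q: "1 \<le> q"
    and kappa_Cq: "C_on q \<Omega> \<kappa>"
    and rec_Cq: "\<And>\<nu>. C_on q \<Omega> (\<kappa>rec \<nu>)"
    and reconstruction: "\<And>\<alpha>. mi_degree \<alpha> \<le> q \<Longrightarrow>
          (\<lambda>\<nu>. mi_deriv \<Omega> \<alpha> (\<kappa>rec \<nu>) (X \<nu> (i \<nu>))
                - mi_deriv \<Omega> \<alpha> \<kappa> (X \<nu> (i \<nu>)) / 2 ^ mi_degree \<alpha>)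
            \<in> O[F](\<lambda>\<nu>. h \<nu> (X \<nu> (i \<nu>)) ^ (q + 1 - mi_degree \<alpha>))"
    and r: "2 \<le> r"
    and rec_smooth: "smooth_family F \<Omega> (\<lambda>\<nu>. X \<nu> (i \<nu>)) r \<kappa>rec"
    and laplace: "laplace_consistent F \<Omega> N X h i c r p"
  shows "let M = (\<lambda>\<alpha> \<nu>. diffusion_moment (N \<nu>) (X \<nu>) (h \<nu>) (i \<nu>) (\<kappa>rec \<nu>) (c \<nu>) \<alpha>);
             H = (\<lambda>s \<nu>. h \<nu> (X \<nu> (i \<nu>)) ^ s)
    in (\<forall>\<nu>. M (\<lambda>_. 0) \<nu> = 0) \<and>
       (\<forall>k. \<exists>e1 \<in> O[F](H p). \<exists>e2 \<in> O[F](H q).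
          \<forall>\<nu>. M (mi_unit k) \<nu> = partial_deriv \<Omega> k \<kappa> (X \<nu> (i \<nu>)) + e1 \<nu> + e2 \<nu>) \<and>
       (\<forall>k. \<exists>e1 \<in> O[F](H p). \<exists>e2 \<in> O[F](H (q + 1)).
          \<forall>\<nu>. M (\<lambda>l. 2 * mi_unit k l) \<nu> = 2 * \<kappa> (X \<nu> (i \<nu>)) + e1 \<nu> + e2 \<nu>) \<and>
       (\<forall>\<alpha>. \<alpha> \<noteq> (\<lambda>_. 0) \<and> (\<forall>k. \<alpha> \<noteq> mi_unit k \<and> \<alpha> \<noteq> (\<lambda>l. 2 * mi_unit k l)) \<longrightarrow>
          M \<alpha> \<in> O[F](H p))"
proof -
  let ?y = "\<lambda>\<nu>. X \<nu> (i \<nu>)"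
  let ?H = "\<lambda>s \<nu>. h \<nu> (?y \<nu>) ^ s"
  let ?M = "\<lambda>\<alpha> \<nu>. diffusion_moment (N \<nu>) (X \<nu>) (h \<nu>) (i \<nu>) (\<kappa>rec \<nu>) (c \<nu>) \<alpha>"
  let ?L = "\<lambda>\<alpha> \<nu>. laplacian \<Omega> (\<lambda>x. mi_power (x - ?y \<nu>) \<alpha> * \<kappa>rec \<nu> x) (?y \<nu>)"
  have y: "?y \<nu> \<in> \<Omega>" for \<nu>
    using cloud[of \<nu>] index[of \<nu>] by (auto simp: point_cloud_def)
  have C2: "C_on 2 \<Omega> (\<kappa>rec \<nu>)" for \<nu>
    using rec_smooth C_on_mono[OF r] by (auto simp: smooth_family_def)
  have "i \<nu> \<in> stencil (N \<nu>) (X \<nu>) (h \<nu>) (i \<nu>)" for \<nu>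
    using index[of \<nu>] h_pos[OF y, of \<nu> \<nu>] by (auto simp: stencil_def)
  then have zero: "?M (\<lambda>_. 0) \<nu> = 0" for \<nu>
    by (rule diffusion_moment_zero)
  have moment: "(\<lambda>\<nu>. ?M \<alpha> \<nu> - ?L \<alpha> \<nu>) \<in> O[F](?H p)" if "\<alpha> \<noteq> (\<lambda>_. 0)" for \<alpha>
  proof -
    \<comment> \<open>The test function varies with \<open>\<nu>\<close> through both
      \<open>\<kappa>rec \<nu>\<close> and the centre \<open>?y \<nu>\<close>, so consistency is
      applied to a family rather than to one fixed function.\<close>
    have "(\<lambda>\<nu>. ?L \<alpha> \<nu> - ?M \<alpha> \<nu>) \<in> O[F](?H p)"
      using laplace[unfolded laplace_consistent_def, rule_format,
          OF smooth_family_mi_power[OF domain rec_smooth]]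
      by (simp add: diffusion_moment_eq_discrete_laplacian[OF that])
    then have "(\<lambda>\<nu>. - (?L \<alpha> \<nu> - ?M \<alpha> \<nu>)) \<in> O[F](?H p)"
      by (simp only: landau_o.big.uminus_in_iff)
    then show ?thesis
      by simp
  qed
  have lap: "?L \<alpha> \<nu> = (if \<alpha> = mi_unit l then 2 * partial_deriv \<Omega> l (\<kappa>rec \<nu>) (?y \<nu>)
      else if \<alpha> = (\<lambda>k. 2 * mi_unit l k) then 2 * \<kappa>rec \<nu> (?y \<nu>) else 0)" if "0 < \<alpha> l" for \<alpha> l \<nu>
    using laplacian_mi_power[OF domain C2 y, of \<alpha> l \<nu> \<nu>] that by blast
  have unit: "\<exists>e1 \<in> O[F](?H p). \<exists>e2 \<in> O[F](?H q).
      \<forall>\<nu>. ?M (mi_unit k) \<nu> = partial_deriv \<Omega> k \<kappa> (?y \<nu>) + e1 \<nu> + e2 \<nu>" for k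
  proof -
    have k: "mi_unit k \<noteq> (\<lambda>_. 0)" "0 < mi_unit k k" "mi_degree (mi_unit k) = 1"
      by (auto simp: mi_unit_def fun_eq_iff mi_degree_def)
    \<comment> \<open>For degree 1 the reconstruction property carries the factor 1/2, which cancels
      the 2 of the cross term, and its error exponent is \<open>q + 1 - 1 = q\<close>.\<close>
    have "(\<lambda>\<nu>. partial_deriv \<Omega> k (\<kappa>rec \<nu>) (?y \<nu>) - partial_deriv \<Omega> k \<kappa> (?y \<nu>) / 2) \<in> O[F](?H q)"
      using reconstruction[of "mi_unit k"] q k(3) by (simp add: mi_deriv_unit)
    then have "(\<lambda>\<nu>. 2 * (partial_deriv \<Omega> k (\<kappa>rec \<nu>) (?y \<nu>) - partial_deriv \<Omega> k \<kappa> (?y \<nu>) / 2)) \<in> O[F](?H q)"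
      by (subst landau_o.big.cmult_in_iff) auto
    then have "(\<lambda>\<nu>. ?L (mi_unit k) \<nu> - partial_deriv \<Omega> k \<kappa> (?y \<nu>)) \<in> O[F](?H q)"
      by (simp add: lap[of "mi_unit k" k, OF k(2)] right_diff_distrib)
    \<comment> \<open>The witness \<open>e1\<close> is the consistency error \<open>?M - ?L\<close>,
      and \<open>e2\<close> is the reconstruction error just estimated.\<close>
    then show ?thesis
      using moment[OF k(1)] by (intro bexI) auto
  qed
  have double: "\<exists>e1 \<in> O[F](?H p). \<exists>e2 \<in> O[F](?H (q + 1)).
      \<forall>\<nu>. ?M (\<lambda>l. 2 * mi_unit k l) \<nu> = 2 * \<kappa> (?y \<nu>) + e1 \<nu> + e2 \<nu>" for k
  proof -
    have k: "(\<lambda>l. 2 * mi_unit k l) \<noteq> (\<lambda>_. 0)" "(\<lambda>l. 2 * mi_unit k l) \<noteq> mi_unit k"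
        "0 < 2 * mi_unit k k"
      by (auto simp: mi_unit_def fun_eq_iff)
    \<comment> \<open>Degree 0 of the reconstruction property: no derivative is taken, so the full
      order \<open>q + 1\<close> is available.\<close>
    have "(\<lambda>\<nu>. \<kappa>rec \<nu> (?y \<nu>) - \<kappa> (?y \<nu>)) \<in> O[F](?H (q + 1))"
      using reconstruction[of "\<lambda>_. 0"] by (simp add: mi_deriv_zero mi_degree_def)
    then have "(\<lambda>\<nu>. 2 * (\<kappa>rec \<nu> (?y \<nu>) - \<kappa> (?y \<nu>))) \<in> O[F](?H (q + 1))"
      by (subst landau_o.big.cmult_in_iff) auto
    then have "(\<lambda>\<nu>. ?L (\<lambda>l. 2 * mi_unit k l) \<nu> - 2 * \<kappa> (?y \<nu>)) \<in> O[F](?H (q + 1))"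
      using k(2) by (simp add: lap[of "\<lambda>l. 2 * mi_unit k l" k, OF k(3)] right_diff_distrib)
    then show ?thesis
      using moment[OF k(1)] by (intro bexI) auto
  qed
  have other: "?M \<alpha> \<in> O[F](?H p)"
    if \<alpha>: "\<alpha> \<noteq> (\<lambda>_. 0)" "\<And>k. \<alpha> \<noteq> mi_unit k" "\<And>k. \<alpha> \<noteq> (\<lambda>l. 2 * mi_unit k l)" for \<alpha>
  proof -
    obtain l where "0 < \<alpha> l"
      using \<alpha>(1) by fastforce
    \<comment> \<open>The exact Laplacian of the test function is 0 here, so the moment is nothing
      but the consistency error.\<close>
    then show ?thesis
      using moment[OF \<alpha>(1)] \<alpha>(2,3) by (simp add: lap[of \<alpha> l])
  qed
  show ?thesis
    unfolding Let_def using zero unit double other by blast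
qed

end
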